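(* The function $$(1^n\,0\,1^{a_1}\,0\,\dots\,0\,1^{a_k})\ \mapsto\ \binom{n}{a_1,\ldots,a_k}$$ is in $\#\mathsf{L}$. Here $k$ is not assumed to be fixed.
   Context: $\binom{n}{a_1,\dots,a_k}=\frac{n!}{a_1!\cdots a_k!}$ is the multinomial coefficient, for non-negative integers $a_1,\dots,a_k$ with $a_1+\dots+a_k=n$. The alphabet is $\Sigma=\{0,1\}$; $1^a$ is the string of $a$ ones and juxtaposition is concatenation. A function given only on strings of a displayed form is extended by $0$ to all other strings. $\#\mathsf{L}$ is the class of functions $f:\Sigma^*\to\mathbb{N}_0$ such that $f(x)$ is the number of accepting computation paths on input $x$ of a fixed nondeterministic Turing machine with read-only input tape that uses $O(\log|x|)$ work space and halts on every computation path. Equivalently: there are a polynomial $q$ and a deterministic $O(\log|x|)$-space Turing machine $M$ with an additional read-once, left-to-right witness tape such that $f(x)=\#\{w\in\Sigma^{q(|x|)}\mid M(x,w)=\mathsf{yes}\}$. *)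

theory Defs
  imports Complex_Main "HOL-Library.Landau_Symbols"
begin

section \<open>Nondeterministic Turing machines with a read-only input tape\<close>

text \<open>Strings over the alphabet \<open>{0, 1}\<close> are Boolean lists, with \<open>1 = True\<close> and \<open>0 = False\<close>.
  On input \<open>x\<close>, cell \<open>0\<close> of the input tape holds a left end marker, cells \<open>1, \<dots>, |x|\<close> hold \<open>x\<close> and
  cell \<open>|x| + 1\<close> holds a right end marker.\<close>

datatype input_symbol = Left_End | Right_End | Bit bool

definition input_symbol_at :: "bool list \<Rightarrow> int \<Rightarrow> input_symbol" where
  "input_symbol_at x p =
     (if p \<le> 0 then Left_End
      else if p > int (length x) then Right_End
      else Bit (x ! nat (p - 1)))"

datatype move = Move_Left | Stay | Move_Right

fun offset :: "move \<Rightarrow> int" where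
  "offset Move_Left = -1"
| "offset Stay = 0"
| "offset Move_Right = 1"

text \<open>A transition \<open>(q, i, rs, q', ws, d, ds)\<close> is enabled in state \<open>q\<close> when the input head reads \<open>i\<close> and
  the work heads read \<open>rs\<close>; it enters state \<open>q'\<close>, makes the work heads write \<open>ws\<close>, and moves the
  input head by \<open>d\<close> and the work heads by \<open>ds\<close>. All lists are indexed by the work tapes.\<close>

type_synonym ('q, 's) transition =
  "'q \<times> input_symbol \<times> 's list \<times> 'q \<times> 's list \<times> move \<times> move list"

record ('q, 's) ntm =
  start_state :: 'q
  accepting_states :: "'q set"
  blank :: 's
  tape_count :: nat
  transitions :: "('q, 's) transition set"

text \<open>Finiteness of the transition set means that only finitely many states and work symbols are ever
  used. The input head may not leave the part of the tape delimited by the end markers; otherwise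
  its position could serve as an unbounded counter.\<close>

definition well_formed :: "('q, 's) ntm \<Rightarrow> bool" where
  "well_formed M \<longleftrightarrow>
     finite (transitions M) \<and>
     (\<forall>(q, i, rs, q', ws, d, ds) \<in> transitions M.
        length rs = tape_count M \<and> length ws = tape_count M \<and> length ds = tape_count M \<and>
        (i = Left_End \<longrightarrow> d \<noteq> Move_Left) \<and> (i = Right_End \<longrightarrow> d \<noteq> Move_Right))"

text \<open>Work tapes are infinite in both directions; a work tape is given by its contents and the position
  of its head.\<close>

type_synonym 's tape = "(int \<Rightarrow> 's) \<times> int"

record ('q, 's) config =
  state :: 'q
  input_pos :: int
  work_tapes :: "'s tape list"

fun read_tape :: "'s tape \<Rightarrow> 's" where
  "read_tape (f, p) = f p"

fun update_tape :: "'s tape \<Rightarrow> 's \<times> move \<Rightarrow> 's tape" where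
  "update_tape (f, p) (s, d) = (f(p := s), p + offset d)"

definition initial_config :: "('q, 's) ntm \<Rightarrow> ('q, 's) config" where
  "initial_config M =
     \<lparr>state = start_state M, input_pos = 0,
      work_tapes = replicate (tape_count M) (\<lambda>_. blank M, 0)\<rparr>"

definition step :: "('q, 's) ntm \<Rightarrow> bool list \<Rightarrow> ('q, 's) config \<Rightarrow> ('q, 's) config \<Rightarrow> bool" where
  "step M x c c' \<longleftrightarrow>
     (\<exists>q' ws d ds.
        (state c, input_symbol_at x (input_pos c), map read_tape (work_tapes c), q', ws, d, ds)
          \<in> transitions M \<and>
        c' = \<lparr>state = q', input_pos = input_pos c + offset d,
              work_tapes = map2 update_tape (work_tapes c) (zip ws ds)\<rparr>)"

definition halting :: "('q, 's) ntm \<Rightarrow> bool list \<Rightarrow> ('q, 's) config \<Rightarrow> bool" where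
  "halting M x c \<longleftrightarrow> (\<nexists>c'. step M x c c')"

definition halts_on_every_path :: "('q, 's) ntm \<Rightarrow> bool list \<Rightarrow> bool" where
  "halts_on_every_path M x \<longleftrightarrow>
     (\<nexists>c :: nat \<Rightarrow> ('q, 's) config. c 0 = initial_config M \<and> (\<forall>i. step M x (c i) (c (Suc i))))"

text \<open>Computation paths, not necessarily maximal. For a well-formed machine, distinct transitions enabled
  in the same configuration lead to distinct configurations, so that recording the configurations is
  the same as recording the nondeterministic choices.\<close>

definition partial_path :: "('q, 's) ntm \<Rightarrow> bool list \<Rightarrow> ('q, 's) config list \<Rightarrow> bool" where
  "partial_path M x cs \<longleftrightarrow>
     cs \<noteq> [] \<and> hd cs = initial_config M \<and> successively (step M x) cs"

definition accepting_paths :: "('q, 's) ntm \<Rightarrow> bool list \<Rightarrow> ('q, 's) config list set" where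
  "accepting_paths M x =
     {cs. partial_path M x cs \<and> halting M x (last cs) \<and> state (last cs) \<in> accepting_states M}"

text \<open>The number of work tape cells visited along a path, summed over the work tapes.\<close>

definition path_space :: "('q, 's) ntm \<Rightarrow> ('q, 's) config list \<Rightarrow> nat" where
  "path_space M cs = (\<Sum>t<tape_count M. card ((\<lambda>c. snd (work_tapes c ! t)) ` set cs))"

definition uses_log_space :: "('q, 's) ntm \<Rightarrow> bool" where
  "uses_log_space M \<longleftrightarrow>
     (\<exists>s :: nat \<Rightarrow> nat. (\<lambda>n. real (s n)) \<in> O(\<lambda>n. ln (real n)) \<and>
        (\<forall>x cs. partial_path M x cs \<longrightarrow> path_space M cs \<le> s (length x)))"

text \<open>States and work symbols are natural numbers, which is no restriction as only finitely many of
  them are used.\<close>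

definition sharp_L :: "(bool list \<Rightarrow> nat) set" where
  "sharp_L =
     {f. \<exists>M :: (nat, nat) ntm.
           well_formed M \<and> uses_log_space M \<and> (\<forall>x. halts_on_every_path M x) \<and>
           (\<forall>x. f x = card (accepting_paths M x))}"

text \<open>The cardinality in \<^const>\<open>sharp_L\<close> is never that of an infinite set.\<close>

lemma finite_step:
  assumes "well_formed M"
  shows "finite {c'. step M x c c'}"
proof -
  have "{c'. step M x c c'} \<subseteq>
    (\<lambda>(q, i, rs, q', ws, d, ds).
       \<lparr>state = q', input_pos = input_pos c + offset d,
        work_tapes = map2 update_tape (work_tapes c) (zip ws ds)\<rparr>) ` transitions M"
    unfolding step_def by force
  moreover have "finite (transitions M)"
    using assms by (simp add: well_formed_def)
  ultimately show ?thesis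
    by (meson finite_imageI finite_subset)
qed

lemma finite_accepting_paths:
  fixes M :: "('q, 's) ntm"
  assumes wf: "well_formed M" and halts: "halts_on_every_path M x"
  shows "finite (accepting_paths M x)"
proof -
  define P where "P c = {cs. cs \<noteq> [] \<and> hd cs = c \<and> successively (step M x) cs}" for c
  have P_eq: "P c \<subseteq> insert [c] (Cons c ` (\<Union>c' \<in> {c'. step M x c c'}. P c'))" for c
  proof
    fix cs assume cs: "cs \<in> P c"
    then obtain cs' where cs': "cs = c # cs'"
      by (cases cs) (auto simp: P_def)
    show "cs \<in> insert [c] (Cons c ` (\<Union>c' \<in> {c'. step M x c c'}. P c'))"
      using cs cs' by (cases cs') (auto simp: P_def)
  qed
  have succ: "\<exists>c'. step M x c c' \<and> infinite (P c')" if "infinite (P c)" for c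
  proof (rule ccontr)
    assume "\<not> ?thesis"
    then have "finite (insert [c] (Cons c ` (\<Union>c' \<in> {c'. step M x c c'}. P c')))"
      using finite_step[OF wf] by auto
    then show False
      using that P_eq finite_subset by blast
  qed
  have "finite (P (initial_config M))"
  proof (rule ccontr)
    assume inf: "infinite (P (initial_config M))"
    define f where "f c = (SOME c'. step M x c c' \<and> infinite (P c'))" for c
    have f: "step M x c (f c) \<and> infinite (P (f c))" if "infinite (P c)" for c
      unfolding f_def using someI_ex[OF succ[OF that]] .
    have inf_all: "infinite (P ((f ^^ i) (initial_config M)))" for i
      by (induction i) (use inf f in auto)
    have "\<exists>c. c 0 = initial_config M \<and> (\<forall>i. step M x (c i) (c (Suc i)))"
      by (rule exI[of _ "\<lambda>i. (f ^^ i) (initial_config M)"]) (use f inf_all in auto)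
    with halts show False
      by (simp add: halts_on_every_path_def)
  qed
  moreover have "accepting_paths M x \<subseteq> P (initial_config M)"
    by (auto simp: accepting_paths_def partial_path_def P_def)
  ultimately show ?thesis
    by (rule rev_finite_subset)
qed


section \<open>The multinomial coefficient as a function on strings\<close>

definition multinomial :: "nat \<Rightarrow> nat list \<Rightarrow> nat" where
  "multinomial n as = fact n div (\<Prod>a\<leftarrow>as. fact a)"

text \<open>The string \<open>1\<^sup>n 0 1\<^bsup>a\<^sub>1\<^esup> 0 \<dots> 0 1\<^bsup>a\<^sub>k\<^esup>\<close>, for \<open>as = [a\<^sub>1, \<dots>, a\<^sub>k]\<close>.\<close>

fun encode :: "nat \<times> nat list \<Rightarrow> bool list" where
  "encode (n, as) = replicate n True @ concat (map (\<lambda>a. False # replicate a True) as)"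

definition multinomial_domain :: "(nat \<times> nat list) set" where
  "multinomial_domain = {(n, as). as \<noteq> [] \<and> sum_list as = n}"

definition extend_by_zero :: "('a \<Rightarrow> bool list) \<Rightarrow> 'a set \<Rightarrow> ('a \<Rightarrow> nat) \<Rightarrow> bool list \<Rightarrow> nat" where
  "extend_by_zero e D g x = (if x \<in> e ` D then g (inv_into D e x) else 0)"

definition multinomial_string :: "bool list \<Rightarrow> nat" where
  "multinomial_string = extend_by_zero encode multinomial_domain (\<lambda>(n, as). multinomial n as)"

lemma encode_Cons:
  "encode (n, a # as) = replicate n True @ False # encode (a, as)"
  by simp

lemma replicate_append_False_eq_iff:
  "replicate m True @ False # xs = replicate n True @ False # ys \<longleftrightarrow> m = n \<and> xs = ys"
proof (induction m arbitrary: n)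
  case 0
  then show ?case by (cases n) auto
next
  case (Suc m)
  then show ?case by (cases n) auto
qed

lemma encode_eq_iff: "encode (m, as) = encode (n, bs) \<longleftrightarrow> m = n \<and> as = bs"
proof (induction as arbitrary: m n bs)
  case Nil
  have "False \<notin> set (encode (m, []))" for m by simp
  moreover have "False \<in> set (encode (n, b # bs))" for b bs by simp
  ultimately have "encode (m, []) \<noteq> encode (n, b # bs)" for b bs by metis
  moreover have "encode (m, []) = encode (n, []) \<longleftrightarrow> m = n" by simp
  ultimately show ?case by (cases bs) auto
next
  case (Cons a as)
  show ?case
  proof (cases bs)
    case Nil
    have "False \<in> set (encode (m, a # as))" "False \<notin> set (encode (n, []))" by simp_all
    then show ?thesis unfolding Nil by metis
  next
    case (Cons b bs')
    show ?thesis
      unfolding Cons encode_Cons replicate_append_False_eq_iff Cons.IH by auto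
  qed
qed

lemma inj_encode: "inj encode"
  by (rule injI) (metis encode_eq_iff surj_pair)

lemma multinomial_string_encode:
  assumes "as \<noteq> []" "sum_list as = n"
  shows "multinomial_string (encode (n, as)) = multinomial n as"
proof -
  have "(n, as) \<in> multinomial_domain"
    using assms by (simp add: multinomial_domain_def)
  then show ?thesis
    using inv_into_f_f[OF inj_on_subset[OF inj_encode subset_UNIV]]
    by (auto simp: multinomial_string_def extend_by_zero_def simp del: encode.simps)
qed

lemma multinomial_string_other:
  assumes "\<And>n as. as \<noteq> [] \<Longrightarrow> sum_list as = n \<Longrightarrow> x \<noteq> encode (n, as)"
  shows "multinomial_string x = 0"
  using assms
  by (auto simp: multinomial_string_def extend_by_zero_def multinomial_domain_def
      simp del: encode.simps)

end

theory Submission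
  imports Defs "HOL-Library.Countable"
begin

text \<open>
  With \<open>r\<^sub>1 = n\<close> and \<open>r\<^bsub>i+1\<^esub> = r\<^sub>i - a\<^sub>i\<close>, the multinomial coefficient is the product of the binomial
  coefficients \<open>r\<^sub>i choose a\<^sub>i\<close>, so a machine may treat the blocks \<open>1\<^bsup>a\<^sub>i\<^esup>\<close> one after the other and
  produce \<open>r\<^sub>i choose a\<^sub>i\<close> branches for each of them. It does so in a single left-to-right pass
  over the input with two counters \<open>A\<close> and \<open>B\<close>, both at most \<open>n\<close> and hence of logarithmic size in binary.
  The prefix \<open>1\<^sup>n\<close> is loaded into \<open>A\<close>. At the start of a block \<open>A = r\<^sub>i\<close> and \<open>B = 0\<close>; each step of
  the block decrements \<open>A\<close>, and nondeterministically either consumes a symbol \<open>1\<close> of the block or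
  increments \<open>B\<close>: of \<open>n\<close> letters to be distributed, the current one is put into the block or passed on to
  the later blocks. If \<open>A\<close> reaches \<open>0\<close> exactly when the block is used up, which happens on
  \<open>r\<^sub>i choose a\<^sub>i\<close> branches, then \<open>B = r\<^bsub>i+1\<^esub>\<close>, and the counters exchange their roles. At the right
  end of the input the machine accepts if both counters are \<open>0\<close>, which enforces \<open>\<Sum> a\<^sub>i = n\<close>.

  A zero test is a guess that is verified afterwards: a wrong guess, like a decrement of \<open>0\<close>, ends in a
  rejecting configuration and contributes no accepting path. Thus each operation on the
  counters is a single sweep over the work tape, whose cells hold one bit of either counter, and a sweep
  multiplies the number of paths by \<open>1\<close> or \<open>0\<close> (\<open>paths_launch\<close>, \<open>paths_launch_stuck\<close>).
  The block count (\<open>phase_paths_block\<close>) is then Pascal's rule, and \<open>ways_eq_multinomial\<close> identifies the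
  product. Termination and the space bound are obtained along with the count, as all three are part of
  the inductive predicate \<open>path_count\<close>.
\<close>

section \<open>Counting accepting paths by well-founded recursion\<close>

text \<open>\<open>path_count M x I c v\<close>: every path from \<open>c\<close> is finite and stays in configurations satisfying
  \<open>I\<close>, and exactly \<open>v\<close> of the paths from \<open>c\<close> are accepting. Being inductive, the predicate
  establishes termination, an invariant and the count at the same time.\<close>

inductive path_count ::
    "('q, 's) ntm \<Rightarrow> bool list \<Rightarrow> (('q, 's) config \<Rightarrow> bool) \<Rightarrow> ('q, 's) config \<Rightarrow> nat \<Rightarrow> bool"
  for M x I where
  path_count_halt:
    "I c \<Longrightarrow> {c'. step M x c c'} = {} \<Longrightarrow>
       path_count M x I c (of_bool (state c \<in> accepting_states M))"
| path_count_step: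
    "I c \<Longrightarrow> {c'. step M x c c'} = S \<Longrightarrow> finite S \<Longrightarrow> S \<noteq> {} \<Longrightarrow>
       (\<And>c'. c' \<in> S \<Longrightarrow> path_count M x I c' (g c')) \<Longrightarrow> path_count M x I c (sum g S)"

lemma path_count_det:
  assumes "I c" "{d. step M x c d} = {c'}" "path_count M x I c' v"
  shows "path_count M x I c v"
  using path_count_step[of I c M x "{c'}" "\<lambda>_. v"] assms by simp

lemma path_count_branch:
  assumes "I c" "{d. step M x c d} = {c1, c2}" "c1 \<noteq> c2"
    and "path_count M x I c1 v1" "path_count M x I c2 v2"
  shows "path_count M x I c (v1 + v2)"
proof -
  let ?g = "\<lambda>d. if d = c1 then v1 else v2"
  have "path_count M x I c (sum ?g {c1, c2})"
  proof (rule path_count_step)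
    show "path_count M x I c' (?g c')" if "c' \<in> {c1, c2}" for c'
      using that assms(4,5) by (cases "c' = c1") simp_all
  qed (use assms(1,2) in simp_all)
  then show ?thesis
    using assms(3) by simp
qed

text \<open>Accepting computation paths with an arbitrary first configuration.\<close>

definition accepting_paths_from ::
    "('q, 's) ntm \<Rightarrow> bool list \<Rightarrow> ('q, 's) config \<Rightarrow> ('q, 's) config list set" where
  "accepting_paths_from M x c =
     {cs. cs \<noteq> [] \<and> hd cs = c \<and> successively (step M x) cs \<and>
       halting M x (last cs) \<and> state (last cs) \<in> accepting_states M}"

lemma accepting_paths_from_halt:
  assumes "{c'. step M x c c'} = {}"
  shows "accepting_paths_from M x c = (if state c \<in> accepting_states M then {[c]} else {})"
proof -
  have no_step: "\<not> step M x c c'" for c'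
    using assms by blast
  have "accepting_paths_from M x c \<subseteq> {[c]}"
  proof
    fix cs assume "cs \<in> accepting_paths_from M x c"
    then obtain cs' where "cs = c # cs'" "successively (step M x) (c # cs')"
      by (cases cs) (auto simp: accepting_paths_from_def)
    then show "cs \<in> {[c]}"
      using no_step by (simp add: successively_Cons)
  qed
  moreover have "[c] \<in> accepting_paths_from M x c \<longleftrightarrow> state c \<in> accepting_states M"
    using no_step by (simp add: accepting_paths_from_def halting_def)
  ultimately show ?thesis
    by (simp add: subset_singleton_iff) blast
qed

lemma accepting_paths_from_step:
  assumes S: "{c'. step M x c c'} = S" "S \<noteq> {}"
  shows "accepting_paths_from M x c = (#) c ` (\<Union>c'\<in>S. accepting_paths_from M x c')"
proof
  have S_iff: "c' \<in> S \<longleftrightarrow> step M x c c'" for c'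
    using S(1) by blast
  show "accepting_paths_from M x c \<subseteq> (#) c ` (\<Union>c'\<in>S. accepting_paths_from M x c')"
  proof
    fix cs assume cs: "cs \<in> accepting_paths_from M x c"
    then obtain cs' where cs': "cs = c # cs'"
      by (cases cs) (simp_all add: accepting_paths_from_def)
    have "cs' \<noteq> []"
      using cs S(2) S_iff by (auto simp: cs' accepting_paths_from_def halting_def)
    then have "step M x c (hd cs')" "cs' \<in> accepting_paths_from M x (hd cs')"
      using cs by (simp_all add: cs' accepting_paths_from_def successively_Cons)
    then show "cs \<in> (#) c ` (\<Union>c'\<in>S. accepting_paths_from M x c')"
      unfolding cs' using S_iff by blast
  qed
  show "(#) c ` (\<Union>c'\<in>S. accepting_paths_from M x c') \<subseteq> accepting_paths_from M x c"
    using S_iff by (auto simp: accepting_paths_from_def successively_Cons)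
qed

lemma path_count_card:
  assumes "path_count M x I c v"
  shows "finite (accepting_paths_from M x c) \<and> card (accepting_paths_from M x c) = v"
  using assms
proof induction
  case (path_count_halt c)
  then show ?case by (simp add: accepting_paths_from_halt)
next
  case (path_count_step c S g)
  have "accepting_paths_from M x d \<inter> accepting_paths_from M x e = {}" if "d \<noteq> e" for d e
    using that by (auto simp: accepting_paths_from_def)
  then have "card (\<Union>c'\<in>S. accepting_paths_from M x c') = sum g S"
    using path_count_step.hyps(3) path_count_step.IH by (simp add: card_UN_disjoint)
  moreover have "finite (\<Union>c'\<in>S. accepting_paths_from M x c')"
    using path_count_step.hyps(3) path_count_step.IH by blast
  ultimately show ?case
    unfolding accepting_paths_from_step[OF path_count_step.hyps(2,4)] by (simp add: card_image)
qed

lemma path_count_invariant: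
  assumes "path_count M x I c v" "cs \<noteq> []" "hd cs = c" "successively (step M x) cs" "c' \<in> set cs"
  shows "I c'"
  using assms
proof (induction arbitrary: cs)
  case (path_count_halt c)
  obtain cs' where cs: "cs = c # cs'"
    using path_count_halt.prems by (cases cs) auto
  have "cs' = []"
    using path_count_halt.hyps(2) path_count_halt.prems(3) by (simp add: cs successively_Cons)
  then show ?case
    using path_count_halt.prems(4) path_count_halt.hyps(1) by (simp add: cs)
next
  case (path_count_step c S g)
  obtain cs' where cs: "cs = c # cs'"
    using path_count_step.prems by (cases cs) auto
  show ?case
  proof (cases "c' = c")
    case True
    then show ?thesis using path_count_step.hyps(1) by simp
  next
    case False
    then have c': "c' \<in> set cs'"
      using path_count_step.prems(4) cs by simp
    then have "cs' \<noteq> []" by auto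
    then have "step M x c (hd cs')" "successively (step M x) cs'"
      using path_count_step.prems(3) by (simp_all add: cs successively_Cons)
    then show ?thesis
      using path_count_step.IH[of "hd cs'" cs'] path_count_step.hyps(2) \<open>cs' \<noteq> []\<close> c' by blast
  qed
qed

lemma path_count_no_infinite_path:
  assumes "path_count M x I c v" "h 0 = c" "\<And>i :: nat. step M x (h i) (h (Suc i))"
  shows False
  using assms
proof (induction arbitrary: h)
  case (path_count_halt c)
  have "step M x c (h 1)"
    using path_count_halt.prems(2)[of 0] path_count_halt.prems(1) by simp
  then show ?case
    using path_count_halt.hyps(2) by blast
next
  case (path_count_step c S g)
  have "step M x c (h 1)"
    using path_count_step.prems(2)[of 0] path_count_step.prems(1) by simp
  then have "h 1 \<in> S"
    using path_count_step.hyps(2) by blast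
  then show ?case
    by (rule path_count_step.IH[of "h 1" "\<lambda>i. h (Suc i)"]) (simp, rule path_count_step.prems(2))
qed


section \<open>Pairs of binary counters and their updates\<close>

text \<open>The binary value of a list of bits, least significant bit first; leading zeros are allowed.\<close>

fun bits_value :: "bool list \<Rightarrow> nat" where
  "bits_value [] = 0"
| "bits_value (b # bs) = of_bool b + 2 * bits_value bs"

text \<open>The partial operations on a counter: identity, successor, predecessor (undefined at \<open>0\<close>) and
  the zero test (undefined elsewhere).\<close>

datatype mode = Keep | Inc | Dec | Zero

fun update :: "mode \<Rightarrow> nat \<Rightarrow> nat option" where
  "update Keep v = Some v"
| "update Inc v = Some (Suc v)"
| "update Dec v = (if v = 0 then None else Some (v - 1))"
| "update Zero v = (if v = 0 then Some 0 else None)"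

text \<open>The effect of an operation on the least significant bit, together with the operation that
  remains to be done on the higher bits: a carry is a pending \<^const>\<open>Inc\<close>, a borrow a pending
  \<^const>\<open>Dec\<close>.\<close>

fun update_bit :: "mode \<Rightarrow> bool \<Rightarrow> (mode \<times> bool) option" where
  "update_bit Keep b = Some (Keep, b)"
| "update_bit Inc b = Some (if b then Inc else Keep, \<not> b)"
| "update_bit Dec b = Some (if b then Keep else Dec, \<not> b)"
| "update_bit Zero b = (if b then None else Some (Zero, False))"

lemma update_bit_None:
  assumes "update_bit m b = None"
  shows "update m (bits_value (b # bs)) = None"
  using assms by (cases m) (auto split: if_splits)

lemma update_bit_Some:
  assumes "update_bit m b = Some (m', b')"
  shows "update m' (bits_value bs) = None \<Longrightarrow> update m (bits_value (b # bs)) = None"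
    and "update m' (bits_value bs) = Some (bits_value bs') \<Longrightarrow>
      update m (bits_value (b # bs)) = Some (bits_value (b' # bs'))"
  using assms by (cases m; auto split: if_splits)+

text \<open>A list of pairs of bits holds two counters, one per component. A sweep performs an operation on
  each of them simultaneously.\<close>

fun sweep :: "mode \<Rightarrow> mode \<Rightarrow> (bool \<times> bool) list \<Rightarrow> (bool \<times> bool) list option" where
  "sweep m1 m2 [] =
     (if m1 = Dec \<or> m2 = Dec then None
      else if m1 = Inc \<or> m2 = Inc then Some [(m1 = Inc, m2 = Inc)]
      else Some [])"
| "sweep m1 m2 ((a, b) # ws) =
     (case (update_bit m1 a, update_bit m2 b) of
        (Some (m1', a'), Some (m2', b')) \<Rightarrow> map_option ((#) (a', b')) (sweep m1' m2' ws)
      | _ \<Rightarrow> None)"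

abbreviation fst_value :: "(bool \<times> bool) list \<Rightarrow> nat" where
  "fst_value ws \<equiv> bits_value (map fst ws)"

abbreviation snd_value :: "(bool \<times> bool) list \<Rightarrow> nat" where
  "snd_value ws \<equiv> bits_value (map snd ws)"

lemma sweep_None:
  "sweep m1 m2 ws = None \<Longrightarrow>
     update m1 (fst_value ws) = None \<or> update m2 (snd_value ws) = None"
proof (induction ws arbitrary: m1 m2)
  case Nil
  then show ?case by (cases m1; cases m2) auto
next
  case (Cons w ws)
  obtain a b where w: "w = (a, b)" by (cases w)
  consider "update_bit m1 a = None" | "update_bit m2 b = None"
    | m1' a' m2' b' where "update_bit m1 a = Some (m1', a')" "update_bit m2 b = Some (m2', b')"
    by (cases "update_bit m1 a"; cases "update_bit m2 b") auto
  then show ?case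
  proof cases
    case 3
    then have "sweep m1' m2' ws = None"
      using Cons.prems w by simp
    then show ?thesis
      using Cons.IH 3 update_bit_Some(1) w by (metis fst_conv list.simps(9) snd_conv)
  qed (simp_all add: w update_bit_None del: bits_value.simps)
qed

lemma sweep_Cons_SomeE:
  assumes "sweep m1 m2 ((a, b) # ws) = Some ws'"
  obtains m1' a' m2' b' us where "update_bit m1 a = Some (m1', a')"
    "update_bit m2 b = Some (m2', b')" "sweep m1' m2' ws = Some us" "ws' = (a', b') # us"
  using assms by (auto split: option.splits)

lemma sweep_Some:
  "sweep m1 m2 ws = Some ws' \<Longrightarrow>
     update m1 (fst_value ws) = Some (fst_value ws') \<and>
     update m2 (snd_value ws) = Some (snd_value ws')"
proof (induction ws arbitrary: m1 m2 ws')
  case Nil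
  then show ?case by (cases m1; cases m2) auto
next
  case (Cons w ws)
  obtain a b where w: "w = (a, b)" by (cases w)
  obtain m1' a' m2' b' us where *: "update_bit m1 a = Some (m1', a')"
    "update_bit m2 b = Some (m2', b')" "sweep m1' m2' ws = Some us" "ws' = (a', b') # us"
    using Cons.prems unfolding w by (rule sweep_Cons_SomeE)
  show ?case
    using Cons.IH[OF *(3)] update_bit_Some(2)[OF *(1)] update_bit_Some(2)[OF *(2)]
    by (simp add: w *(4) del: bits_value.simps)
qed

text \<open>A sweep appends a digit only for an overflow, hence only if the new value needs that digit.\<close>

lemma sweep_length:
  "sweep m1 m2 ws = Some ws' \<Longrightarrow> length ws \<le> L \<Longrightarrow>
     fst_value ws' < 2 ^ L \<Longrightarrow> snd_value ws' < 2 ^ L \<Longrightarrow> length ws' \<le> L"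
proof (induction ws arbitrary: m1 m2 ws' L)
  case Nil
  then show ?case by (cases L) (auto split: if_splits)
next
  case (Cons w ws)
  obtain a b where w: "w = (a, b)" by (cases w)
  obtain m1' a' m2' b' us where *: "update_bit m1 a = Some (m1', a')"
    "update_bit m2 b = Some (m2', b')" "sweep m1' m2' ws = Some us" "ws' = (a', b') # us"
    using Cons.prems(1) unfolding w by (rule sweep_Cons_SomeE)
  obtain L' where L: "L = Suc L'"
    using Cons.prems(2) by (cases L) auto
  have "length us \<le> L'"
    by (rule Cons.IH[OF *(3)]) (use * Cons.prems L in auto)
  then show ?case using * L by simp
qed


section \<open>The machine\<close>

text \<open>One work tape suffices. Cell \<open>0\<close> holds the marker, to which the head returns after each operation;
  the cells to its right hold the digits of both counters, least significant first, and the first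
  blank ends them.\<close>

datatype symbol = Blank | Marker | Cell "bool \<times> bool"

text \<open>A phase is a control state in which no counter operation is in progress: reading the prefix
  \<open>1\<^sup>n\<close>, processing the blocks, or acceptance. The flag of \<open>Select\<close> tells which of the two tracks currently
  plays the role of \<open>A\<close>: the first one for \<^const>\<open>False\<close>, the second one for \<^const>\<open>True\<close>.
  The other states sweep to the right and back, remembering the phase to enter next.\<close>

datatype phase = Load | Select bool | Accept

datatype control = Start | Phase phase | Sweep mode mode phase | Return phase

instance input_symbol :: finite
proof
  have univ: "(UNIV :: input_symbol set) = {Left_End, Right_End} \<union> range Bit"
    using input_symbol.exhaust by auto
  show "finite (UNIV :: input_symbol set)" unfolding univ by simp
qed

instance symbol :: finite
proof
  have univ: "(UNIV :: symbol set) = {Blank, Marker} \<union> range Cell"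
    using symbol.exhaust by auto
  show "finite (UNIV :: symbol set)" unfolding univ by simp
qed

instance move :: finite
proof
  have univ: "(UNIV :: move set) = {Move_Left, Stay, Move_Right}"
    using move.exhaust by auto
  show "finite (UNIV :: move set)" unfolding univ by simp
qed

instance mode :: finite
proof
  have univ: "(UNIV :: mode set) = {Keep, Inc, Dec, Zero}"
    using mode.exhaust by auto
  show "finite (UNIV :: mode set)" unfolding univ by simp
qed

instance phase :: finite
proof
  have univ: "(UNIV :: phase set) = {Load, Accept} \<union> range Select"
    using phase.exhaust by auto
  show "finite (UNIV :: phase set)" unfolding univ by simp
qed

instance control :: finite
proof
  have univ: "(UNIV :: control set) =
      {Start} \<union> range Phase \<union> range (\<lambda>(a, b, t). Sweep a b t) \<union> range Return"
    using control.exhaust by (auto simp: image_iff) metis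
  moreover have "finite \<dots>"
    by simp
  ultimately show "finite (UNIV :: control set)" by simp
qed

text \<open>The first state of a sweep that applies \<open>m1\<close> to \<open>A\<close> and \<open>m2\<close> to \<open>B\<close>, for the flag \<open>f\<close>.\<close>

fun launch :: "bool \<Rightarrow> mode \<Rightarrow> mode \<Rightarrow> phase \<Rightarrow> control" where
  "launch False m1 m2 t = Sweep m1 m2 t"
| "launch True m1 m2 t = Sweep m2 m1 t"

text \<open>The choices available in a phase while the work head reads the marker: the new state and the moves
  of the input head and of the work head. The only nondeterminism of the machine is in
  \<open>Select\<close>, between passing a letter on from \<open>A\<close> to \<open>B\<close> and one further operation. That operation consumes an
  input symbol \<open>1\<close>, or guesses that the block is finished: it verifies \<open>A = 0\<close> and
  exchanges the roles of the counters, or, at the end of the input, verifies \<open>A = B = 0\<close> and accepts.\<close>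

fun phase_moves :: "phase \<Rightarrow> input_symbol \<Rightarrow> (control \<times> move \<times> move) set" where
  "phase_moves Load i =
     (case i of
        Bit b \<Rightarrow>
          if b then {(Sweep Inc Keep Load, Move_Right, Move_Right)}
          else {(Phase (Select False), Move_Right, Stay)}
      | _ \<Rightarrow> {})"
| "phase_moves (Select f) i =
     (case i of
        Left_End \<Rightarrow> {}
      | Bit b \<Rightarrow>
          {(launch f Dec Inc (Select f), Stay, Move_Right),
           (if b then launch f Dec Keep (Select f) else launch f Zero Keep (Select (\<not> f)),
            Move_Right, Move_Right)}
      | Right_End \<Rightarrow>
          {(launch f Dec Inc (Select f), Stay, Move_Right),
           (launch f Zero Zero Accept, Stay, Move_Right)})"
| "phase_moves Accept i = {}"

text \<open>The transition function, giving the new state, the symbol written and the moves of both heads.\<close>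

fun delta :: "control \<Rightarrow> input_symbol \<Rightarrow> symbol \<Rightarrow> (control \<times> symbol \<times> move \<times> move) set" where
  "delta Start i s =
     (if i = Left_End \<and> s = Blank then {(Phase Load, Marker, Move_Right, Stay)} else {})"
| "delta (Phase t) i s =
     (if s = Marker then (\<lambda>(q, d, e). (q, Marker, d, e)) ` phase_moves t i else {})"
| "delta (Sweep m1 m2 t) i s =
     (case s of
        Cell (a, b) \<Rightarrow>
          (case (update_bit m1 a, update_bit m2 b) of
             (Some (m1', a'), Some (m2', b')) \<Rightarrow>
               {(Sweep m1' m2' t, Cell (a', b'), Stay, Move_Right)}
           | _ \<Rightarrow> {})
      | Blank \<Rightarrow>
          if m1 = Dec \<or> m2 = Dec then {}
          else {(Return t, if m1 = Inc \<or> m2 = Inc then Cell (m1 = Inc, m2 = Inc) else Blank,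
                 Stay, Move_Left)}
      | Marker \<Rightarrow> {})"
| "delta (Return t) i s =
     (case s of
        Cell w \<Rightarrow> {(Return t, Cell w, Stay, Move_Left)}
      | Marker \<Rightarrow> {(Phase t, Marker, Stay, Stay)}
      | Blank \<Rightarrow> {})"

text \<open>States and work symbols are turned into natural numbers by their standard enumerations.\<close>

definition machine :: "(nat, nat) ntm" where
  "machine =
     \<lparr>start_state = to_nat Start, accepting_states = {to_nat (Phase Accept)},
      blank = to_nat Blank, tape_count = 1,
      transitions = {(to_nat q, i, [to_nat s], to_nat q', [to_nat s'], d, [e]) | q i s q' s' d e.
        (q', s', d, e) \<in> delta q i s}\<rparr>"

lemma delta_input_move:
  assumes "(q', s', d, e) \<in> delta q i s"
  shows "d \<noteq> Move_Left \<and> (i = Right_End \<longrightarrow> d = Stay)"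
proof -
  have "d \<noteq> Move_Left \<and> (i = Right_End \<longrightarrow> d = Stay)" if "(q', d, e) \<in> phase_moves t i" for t
    using that by (cases t; cases i) (auto split: if_splits)
  then show ?thesis
    using assms by (cases q) (auto split: option.splits if_splits symbol.splits)
qed

lemma well_formed_machine: "well_formed machine"
proof -
  have "transitions machine \<subseteq>
      (\<lambda>(q, i, s, q', s', d, e).
        (to_nat (q :: control), i, [to_nat (s :: symbol)], to_nat (q' :: control),
         [to_nat (s' :: symbol)], d, [e])) ` UNIV"
    by (auto simp: machine_def image_iff)
  then have "finite (transitions machine)"
    by (rule finite_subset) (rule finite_imageI, rule finite)
  then show ?thesis
    unfolding well_formed_def by (auto simp: machine_def dest: delta_input_move)
qed

text \<open>The configuration with control state \<open>q\<close>, input head at \<open>p\<close>, work tape contents \<open>f\<close> and work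
  head at \<open>h\<close>.\<close>

definition conf :: "control \<Rightarrow> int \<Rightarrow> (int \<Rightarrow> symbol) \<Rightarrow> int \<Rightarrow> (nat, nat) config" where
  "conf q p f h = \<lparr>state = to_nat q, input_pos = p, work_tapes = [(to_nat \<circ> f, h)]\<rparr>"

lemma conf_neq: "q \<noteq> q' \<or> p \<noteq> p' \<Longrightarrow> conf q p f h \<noteq> conf q' p' f' h'"
  by (auto simp: conf_def)

lemma steps_conf:
  "{c'. step machine x (conf q p f h) c'} =
     (\<lambda>(q', s, d, e). conf q' (p + offset d) (f(h := s)) (h + offset e)) `
       delta q (input_symbol_at x p) (f h)"
  unfolding step_def machine_def conf_def
  by (force simp: fun_upd_comp image_iff)

lemma initial_config_machine: "initial_config machine = conf Start 0 (\<lambda>_. Blank) 0"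
  by (simp add: initial_config_def machine_def conf_def comp_def)


section \<open>Sweeps of the work tape\<close>

text \<open>The contents of the work tape for given digits of the two counters.\<close>

definition tape_of :: "(bool \<times> bool) list \<Rightarrow> int \<Rightarrow> symbol" where
  "tape_of ws i =
     (if i = 0 then Marker
      else if 0 < i \<and> i \<le> int (length ws) then Cell (ws ! nat (i - 1))
      else Blank)"

lemma tape_of_0 [simp]: "tape_of ws 0 = Marker"
  by (simp add: tape_of_def)

lemma tape_of_cell [simp]: "tape_of (us @ w # ws) (1 + int (length us)) = Cell w"
  by (simp add: tape_of_def)

lemma tape_of_end [simp]: "tape_of us (1 + int (length us)) = Blank"
  by (simp add: tape_of_def)

lemma tape_of_upd_cell:
  "(tape_of (us @ w # ws))(1 + int (length us) := Cell w') = tape_of (us @ w' # ws)"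
proof
  fix i :: int
  have "nat (i - 1) \<noteq> length us" if "i \<noteq> 1 + int (length us)" "0 < i"
    using that by auto
  then show "((tape_of (us @ w # ws))(1 + int (length us) := Cell w')) i = tape_of (us @ w' # ws) i"
    by (auto simp: tape_of_def nth_append nth_Cons')
qed

lemma tape_of_upd_end:
  "(tape_of us)(1 + int (length us) := Cell w) = tape_of (us @ [w])"
  by (rule ext) (auto simp: tape_of_def nth_append)

lemma tape_of_upd_Marker: "(tape_of ws)(0 := Marker) = tape_of ws"
  by (rule fun_upd_idem) simp

lemma tape_of_initial: "(\<lambda>_. Blank)(0 := Marker) = tape_of []"
  by (rule ext) (simp add: tape_of_def)

text \<open>The work head stays on the marker, the first \<open>L\<close> cells after it, and the next one.\<close>

definition head_within :: "nat \<Rightarrow> (nat, nat) config \<Rightarrow> bool" where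
  "head_within L c \<longleftrightarrow> snd (work_tapes c ! 0) \<in> {0..int L + 1}"

lemma head_within_conf [simp]: "head_within L (conf q p f h) \<longleftrightarrow> 0 \<le> h \<and> h \<le> int L + 1"
  by (simp add: head_within_def conf_def)

text \<open>\<open>paths x L c v\<close>: on input \<open>x\<close>, exactly \<open>v\<close> paths from \<open>c\<close> are accepting, and all paths from \<open>c\<close>
  are finite and respect the space bound \<open>L\<close>.\<close>

abbreviation paths :: "bool list \<Rightarrow> nat \<Rightarrow> (nat, nat) config \<Rightarrow> nat \<Rightarrow> bool" where
  "paths x L \<equiv> path_count machine x (head_within L)"

lemma paths_stuck:
  assumes "delta q (input_symbol_at x p) (f h) = {}" "q \<noteq> Phase Accept"
    and "0 \<le> h" "h \<le> int L + 1"
  shows "paths x L (conf q p f h) 0"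
proof -
  have "state (conf q p f h) \<notin> accepting_states machine"
    using assms(2) by (simp add: conf_def machine_def)
  then show ?thesis
    using path_count_halt[of "head_within L" "conf q p f h" machine x] assms
    by (simp add: steps_conf)
qed

lemma paths_accept:
  assumes "0 \<le> h" "h \<le> int L + 1"
  shows "paths x L (conf (Phase Accept) p f h) 1"
proof -
  have "state (conf (Phase Accept) p f h) \<in> accepting_states machine"
    by (simp add: conf_def machine_def)
  then show ?thesis
    using path_count_halt[of "head_within L" "conf (Phase Accept) p f h" machine x] assms
    by (simp add: steps_conf)
qed

lemma paths_det:
  assumes "delta q (input_symbol_at x p) (f h) = {(q', s, d, e)}"
    and "paths x L (conf q' (p + offset d) (f(h := s)) (h + offset e)) v"
    and "0 \<le> h" "h \<le> int L + 1"
  shows "paths x L (conf q p f h) v"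
  using assms by (intro path_count_det[OF _ _ assms(2)]) (simp_all add: steps_conf)

lemma paths_return:
  assumes "paths x L (conf (Phase t) p (tape_of ws) 0) v" "k \<le> length ws" "length ws \<le> L"
  shows "paths x L (conf (Return t) p (tape_of ws) (int k)) v"
  using assms(2)
proof (induction k)
  case 0
  show ?case
    using assms(1) by - (rule paths_det[where h = "int 0"], auto simp: tape_of_upd_Marker)
next
  case (Suc k)
  then obtain us w vs where ws: "ws = us @ w # vs" "length us = k"
    by (metis Suc_le_eq id_take_nth_drop length_take min.absorb2 less_imp_le)
  have "tape_of ws (int (Suc k)) = Cell w"
    using tape_of_cell[of us w vs] by (simp add: ws)
  moreover have "(tape_of ws)(int (Suc k) := Cell w) = tape_of ws"
    by (rule fun_upd_idem) (rule calculation)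
  ultimately show ?case
    using Suc assms(3)
    by - (rule paths_det[where q' = "Return t" and s = "Cell w" and d = Stay and e = Move_Left],
       simp_all)
qed

text \<open>The digits \<open>us\<close> have already been processed, the digits \<open>ws\<close> are still to be read.\<close>

lemma paths_sweep:
  assumes "sweep m1 m2 ws = Some ws'" "length us + length ws' \<le> L" "length us + length ws \<le> L"
    and "paths x L (conf (Phase t) p (tape_of (us @ ws')) 0) v"
  shows "paths x L (conf (Sweep m1 m2 t) p (tape_of (us @ ws)) (1 + int (length us))) v"
  using assms
proof (induction ws arbitrary: m1 m2 us ws')
  case Nil
  have no_borrow: "\<not> (m1 = Dec \<or> m2 = Dec)"
    using Nil.prems(1) by auto
  have ret: "paths x L (conf (Return t) p (tape_of (us @ ws')) (int (length us))) v"
    by (rule paths_return) (use Nil.prems in auto)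
  show ?case
  proof (cases "m1 = Inc \<or> m2 = Inc")
    case True
    then show ?thesis
      using Nil.prems no_borrow ret tape_of_upd_end
      by - (rule paths_det[where q' = "Return t" and s = "Cell (m1 = Inc, m2 = Inc)" and d = Stay
            and e = Move_Left], auto)
  next
    case False
    moreover have "(tape_of us)(1 + int (length us) := Blank) = tape_of us"
      by (rule fun_upd_idem) simp
    ultimately show ?thesis
      using Nil.prems no_borrow ret
      by - (rule paths_det[where q' = "Return t" and s = Blank and d = Stay and e = Move_Left], auto)
  qed
next
  case (Cons w ws)
  obtain a b where w: "w = (a, b)" by (cases w)
  obtain m1' a' m2' b' vs where *: "update_bit m1 a = Some (m1', a')"
    "update_bit m2 b = Some (m2', b')" "sweep m1' m2' ws = Some vs" "ws' = (a', b') # vs"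
    using Cons.prems(1) unfolding w by (rule sweep_Cons_SomeE)
  have "paths x L (conf (Sweep m1' m2' t) p (tape_of ((us @ [(a', b')]) @ ws))
          (1 + int (length (us @ [(a', b')])))) v"
    by (rule Cons.IH[OF *(3)]) (use Cons.prems * in auto)
  then show ?case
    using * w Cons.prems(3) tape_of_upd_cell[of us w ws "(a', b')"]
    by - (rule paths_det[where q' = "Sweep m1' m2' t" and s = "Cell (a', b')" and d = Stay
          and e = Move_Right], auto simp: add.commute)
qed

lemma paths_sweep_stuck:
  assumes "sweep m1 m2 ws = None" "length us + length ws \<le> L"
  shows "paths x L (conf (Sweep m1 m2 t) p (tape_of (us @ ws)) (1 + int (length us))) 0"
  using assms
proof (induction ws arbitrary: m1 m2 us)
  case Nil
  then show ?case by (intro paths_stuck) (auto split: if_splits)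
next
  case (Cons w ws)
  obtain a b where w: "w = (a, b)" by (cases w)
  consider "update_bit m1 a = None" | "update_bit m2 b = None"
    | m1' a' m2' b' where "update_bit m1 a = Some (m1', a')" "update_bit m2 b = Some (m2', b')"
    by (cases "update_bit m1 a"; cases "update_bit m2 b") auto
  then show ?case
  proof cases
    case 3
    then have "sweep m1' m2' ws = None"
      using Cons.prems(1) w by simp
    then have "paths x L (conf (Sweep m1' m2' t) p (tape_of ((us @ [(a', b')]) @ ws))
          (1 + int (length (us @ [(a', b')])))) 0"
      by (rule Cons.IH) (use Cons.prems in auto)
    then show ?thesis
      using 3 w Cons.prems(2) tape_of_upd_cell[of us w ws "(a', b')"]
      by - (rule paths_det[where q' = "Sweep m1' m2' t" and s = "Cell (a', b')" and d = Stay
            and e = Move_Right], auto simp: add.commute)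
  qed (use w Cons.prems(2) in \<open>intro paths_stuck; auto split: option.splits\<close>)+
qed


section \<open>Single steps of the counting procedure\<close>

text \<open>The values of the two counters as the pair \<open>(A, B)\<close>: \<open>A\<close> is the number of letters still to be handled
  in the current block, \<open>B\<close> the number of letters already passed on to the later blocks.\<close>

definition roles :: "bool \<Rightarrow> (bool \<times> bool) list \<Rightarrow> nat \<times> nat" where
  "roles f ws = (if f then (snd_value ws, fst_value ws) else (fst_value ws, snd_value ws))"

lemma roles_swap: "roles f ws = (A, B) \<Longrightarrow> roles (\<not> f) ws = (B, A)"
  by (auto simp: roles_def split: if_splits)

text \<open>The number of accepting paths from the phase \<open>t\<close> depends on the work tape only through the values
  of the counters: leading zeros do not matter.\<close>

definition phase_paths ::
    "bool list \<Rightarrow> nat \<Rightarrow> phase \<Rightarrow> bool \<Rightarrow> int \<Rightarrow> nat \<Rightarrow> nat \<Rightarrow> nat \<Rightarrow> bool" where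
  "phase_paths x L t f p A B v \<longleftrightarrow>
     (\<forall>ws. length ws \<le> L \<longrightarrow> roles f ws = (A, B) \<longrightarrow> paths x L (conf (Phase t) p (tape_of ws) 0) v)"

lemma phase_pathsI:
  assumes "\<And>ws. length ws \<le> L \<Longrightarrow> roles f ws = (A, B) \<Longrightarrow>
    paths x L (conf (Phase t) p (tape_of ws) 0) v"
  shows "phase_paths x L t f p A B v"
  using assms by (simp add: phase_paths_def)

lemma paths_launch:
  assumes "roles f ws = (A, B)" "length ws \<le> L"
    and "update m1 A = Some A'" "update m2 B = Some B'" "A' < 2 ^ L" "B' < 2 ^ L"
    and "phase_paths x L t f p A' B' v"
  shows "paths x L (conf (launch f m1 m2 t) p (tape_of ws) 1) v"
proof -
  define n1 n2 where "n1 = (if f then m2 else m1)" and "n2 = (if f then m1 else m2)"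
  have launch: "launch f m1 m2 t = Sweep n1 n2 t"
    by (cases f) (simp_all add: n1_def n2_def)
  have upd: "update n1 (fst_value ws) = Some (if f then B' else A')"
    "update n2 (snd_value ws) = Some (if f then A' else B')"
    using assms(1,3,4) by (auto simp: n1_def n2_def roles_def split: if_splits)
  then obtain ws' where ws': "sweep n1 n2 ws = Some ws'"
    using sweep_None[of n1 n2 ws] by auto
  have vals: "fst_value ws' = (if f then B' else A')" "snd_value ws' = (if f then A' else B')"
    using sweep_Some[OF ws'] upd by auto
  have "length ws' \<le> L"
    by (rule sweep_length[OF ws' assms(2)]) (use vals assms(5,6) in auto)
  moreover have "roles f ws' = (A', B')"
    using vals by (simp add: roles_def)
  ultimately have "paths x L (conf (Phase t) p (tape_of ws') 0) v"
    using assms(7) by (simp add: phase_paths_def)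
  then show ?thesis
    using paths_sweep[OF ws', of "[]" L x t p v] \<open>length ws' \<le> L\<close> assms(2) by (simp add: launch)
qed

lemma paths_launch_stuck:
  assumes "roles f ws = (A, B)" "length ws \<le> L" "update m1 A = None \<or> update m2 B = None"
  shows "paths x L (conf (launch f m1 m2 t) p (tape_of ws) 1) 0"
proof -
  define n1 n2 where "n1 = (if f then m2 else m1)" and "n2 = (if f then m1 else m2)"
  have launch: "launch f m1 m2 t = Sweep n1 n2 t"
    by (cases f) (simp_all add: n1_def n2_def)
  have "update n1 (fst_value ws) = None \<or> update n2 (snd_value ws) = None"
    using assms(1,3) by (auto simp: n1_def n2_def roles_def split: if_splits)
  then have "sweep n1 n2 ws = None"
    using sweep_Some[of n1 n2 ws] by (cases "sweep n1 n2 ws") auto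
  then show ?thesis
    using paths_sweep_stuck[of n1 n2 ws "[]" L x t p] assms(2) by (simp add: launch)
qed

lemma phase_paths_load_True:
  assumes "input_symbol_at x p = Bit True" "Suc A < 2 ^ L" "B < 2 ^ L"
    and "phase_paths x L Load False (p + 1) (Suc A) B v"
  shows "phase_paths x L Load False p A B v"
proof (rule phase_pathsI)
  fix ws assume "length ws \<le> L" "roles False ws = (A, B)"
  then have "paths x L (conf (launch False Inc Keep Load) (p + 1) (tape_of ws) 1) v"
    using assms(2-) by (intro paths_launch[where A' = "Suc A" and B' = B]) auto
  then show "paths x L (conf (Phase Load) p (tape_of ws) 0) v"
    by - (rule paths_det[where s = Marker and d = Move_Right and e = Move_Right],
        simp_all add: assms(1) tape_of_upd_Marker)
qed

lemma phase_paths_load_False: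
  assumes "input_symbol_at x p = Bit False" "phase_paths x L (Select False) False (p + 1) A B v"
  shows "phase_paths x L Load False p A B v"
proof (rule phase_pathsI)
  fix ws assume "length ws \<le> L" "roles False ws = (A, B)"
  then have "paths x L (conf (Phase (Select False)) (p + 1) (tape_of ws) 0) v"
    using assms(2) by (simp add: phase_paths_def)
  then show "paths x L (conf (Phase Load) p (tape_of ws) 0) v"
    by - (rule paths_det[where s = Marker and d = Move_Right and e = Stay],
        simp_all add: assms(1) tape_of_upd_Marker)
qed

lemma phase_paths_load_end:
  assumes "input_symbol_at x p = Right_End"
  shows "phase_paths x L Load False p A B 0"
  by (intro phase_pathsI paths_stuck) (simp_all add: assms)

lemma launch_neq: "m1 \<noteq> n1 \<or> m2 \<noteq> n2 \<or> t \<noteq> t' \<Longrightarrow> launch f m1 m2 t \<noteq> launch f n1 n2 t'"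
  by (cases f) auto

text \<open>The number of accepting paths in \<open>Select\<close> is the sum over its two choices.\<close>

lemma paths_select:
  assumes "phase_moves (Select f) (input_symbol_at x p) =
      {(launch f Dec Inc (Select f), Stay, Move_Right), (q, d, Move_Right)}"
    and "q \<noteq> launch f Dec Inc (Select f)"
    and "paths x L (conf (launch f Dec Inc (Select f)) p (tape_of ws) 1) v1"
    and "paths x L (conf q (p + offset d) (tape_of ws) 1) v2"
  shows "paths x L (conf (Phase (Select f)) p (tape_of ws) 0) (v1 + v2)"
proof (rule path_count_branch)
  show "{c'. step machine x (conf (Phase (Select f)) p (tape_of ws) 0) c'} =
      {conf (launch f Dec Inc (Select f)) p (tape_of ws) 1, conf q (p + offset d) (tape_of ws) 1}"
    unfolding steps_conf by (simp add: assms(1) tape_of_upd_Marker del: phase_moves.simps)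
  show "conf (launch f Dec Inc (Select f)) p (tape_of ws) 1 \<noteq> conf q (p + offset d) (tape_of ws) 1"
    by (rule conf_neq) (use assms(2) in simp)
qed (use assms(3,4) in simp_all)

lemma paths_transfer:
  assumes "phase_paths x L (Select f) f p A (Suc B) v" "A + Suc B < 2 ^ L"
    and "roles f ws = (Suc A, B)" "length ws \<le> L"
  shows "paths x L (conf (launch f Dec Inc (Select f)) p (tape_of ws) 1) v"
  using assms by (intro paths_launch[where A' = A and B' = "Suc B"]) auto

lemma phase_paths_consume_or_transfer:
  assumes "input_symbol_at x p = Bit True" "A + Suc B < 2 ^ L"
    and "phase_paths x L (Select f) f (p + 1) A B v1"
    and "phase_paths x L (Select f) f p A (Suc B) v2"
  shows "phase_paths x L (Select f) f p (Suc A) B (v1 + v2)"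
proof (rule phase_pathsI)
  fix ws assume ws: "length ws \<le> L" "roles f ws = (Suc A, B)"
  have "paths x L (conf (launch f Dec Keep (Select f)) (p + 1) (tape_of ws) 1) v1"
    using assms(2,3) ws by (intro paths_launch[where A' = A and B' = B]) auto
  moreover have "paths x L (conf (launch f Dec Inc (Select f)) p (tape_of ws) 1) v2"
    by (rule paths_transfer) (use assms ws in auto)
  ultimately have "paths x L (conf (Phase (Select f)) p (tape_of ws) 0) (v2 + v1)"
    by (intro paths_select[where q = "launch f Dec Keep (Select f)" and d = Move_Right])
       (simp_all add: assms(1) launch_neq)
  then show "paths x L (conf (Phase (Select f)) p (tape_of ws) 0) (v1 + v2)"
    by (simp add: add.commute)
qed

lemma phase_paths_consume_stuck:
  assumes "input_symbol_at x p = Bit True"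
  shows "phase_paths x L (Select f) f p 0 B 0"
proof (rule phase_pathsI)
  fix ws assume ws: "length ws \<le> L" "roles f ws = (0, B)"
  have "paths x L (conf (launch f Dec m t) p' (tape_of ws) 1) 0" for m t p'
    by (rule paths_launch_stuck) (use ws in auto)
  then have "paths x L (conf (Phase (Select f)) p (tape_of ws) 0) (0 + 0)"
    by (intro paths_select[where q = "launch f Dec Keep (Select f)" and d = Move_Right])
       (simp_all add: assms(1) launch_neq)
  then show "paths x L (conf (Phase (Select f)) p (tape_of ws) 0) 0"
    by simp
qed

text \<open>At the end of a block only a transfer is possible as long as letters remain.\<close>

lemma phase_paths_transfer:
  assumes "input_symbol_at x p = Bit False \<or> input_symbol_at x p = Right_End" "A + Suc B < 2 ^ L"
    and "phase_paths x L (Select f) f p A (Suc B) v"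
  shows "phase_paths x L (Select f) f p (Suc A) B v"
proof (rule phase_pathsI)
  fix ws assume ws: "length ws \<le> L" "roles f ws = (Suc A, B)"
  have stuck: "paths x L (conf (launch f Zero m t) p' (tape_of ws) 1) 0" for m t p'
    by (rule paths_launch_stuck) (use ws in auto)
  have "paths x L (conf (launch f Dec Inc (Select f)) p (tape_of ws) 1) v"
    by (rule paths_transfer) (use assms ws in auto)
  note launched = this stuck
  have "paths x L (conf (Phase (Select f)) p (tape_of ws) 0) (v + 0)"
    using assms(1)
  proof
    assume "input_symbol_at x p = Bit False"
    with launched show ?thesis
      by (intro paths_select[where q = "launch f Zero Keep (Select (\<not> f))" and d = Move_Right])
         (simp_all add: launch_neq)
  next
    assume "input_symbol_at x p = Right_End"
    with launched show ?thesis
      by (intro paths_select[where q = "launch f Zero Zero Accept" and d = Stay])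
         (simp_all add: launch_neq)
  qed
  then show "paths x L (conf (Phase (Select f)) p (tape_of ws) 0) v"
    by simp
qed

lemma phase_paths_next_block:
  assumes "input_symbol_at x p = Bit False" "B < 2 ^ L"
    and "phase_paths x L (Select (\<not> f)) (\<not> f) (p + 1) B 0 v"
  shows "phase_paths x L (Select f) f p 0 B v"
proof (rule phase_pathsI)
  fix ws assume ws: "length ws \<le> L" "roles f ws = (0, B)"
  have "phase_paths x L (Select (\<not> f)) f (p + 1) 0 B v"
    using assms(3) roles_swap by (fastforce simp: phase_paths_def)
  then have "paths x L (conf (launch f Zero Keep (Select (\<not> f))) (p + 1) (tape_of ws) 1) v"
    using assms(2) ws by (intro paths_launch[where A' = 0 and B' = B]) auto
  moreover have "paths x L (conf (launch f Dec Inc (Select f)) p (tape_of ws) 1) 0"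
    by (rule paths_launch_stuck) (use ws in auto)
  ultimately have "paths x L (conf (Phase (Select f)) p (tape_of ws) 0) (0 + v)"
    by (intro paths_select[where q = "launch f Zero Keep (Select (\<not> f))" and d = Move_Right])
       (simp_all add: assms(1) launch_neq)
  then show "paths x L (conf (Phase (Select f)) p (tape_of ws) 0) v"
    by simp
qed

lemma phase_paths_finish:
  assumes "input_symbol_at x p = Right_End"
  shows "phase_paths x L (Select f) f p 0 B (of_bool (B = 0))"
proof (rule phase_pathsI)
  fix ws assume ws: "length ws \<le> L" "roles f ws = (0, B)"
  have "paths x L (conf (launch f Zero Zero Accept) p (tape_of ws) 1) (of_bool (B = 0))"
  proof (cases "B = 0")
    case True
    have "phase_paths x L Accept f p 0 0 1"
      by (rule phase_pathsI, rule paths_accept) auto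
    then have "paths x L (conf (launch f Zero Zero Accept) p (tape_of ws) 1) 1"
      using ws True by (intro paths_launch[where A' = 0 and B' = 0]) auto
    then show ?thesis using True by simp
  next
    case False
    then have "paths x L (conf (launch f Zero Zero Accept) p (tape_of ws) 1) 0"
      by (intro paths_launch_stuck[OF ws(2,1)]) auto
    then show ?thesis using False by simp
  qed
  moreover have "paths x L (conf (launch f Dec Inc (Select f)) p (tape_of ws) 1) 0"
    by (rule paths_launch_stuck) (use ws in auto)
  ultimately have "paths x L (conf (Phase (Select f)) p (tape_of ws) 0) (0 + of_bool (B = 0))"
    by (intro paths_select[where q = "launch f Zero Zero Accept" and d = Stay])
       (simp_all add: assms(1) launch_neq)
  then show "paths x L (conf (Phase (Select f)) p (tape_of ws) 0) (of_bool (B = 0))"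
    by simp
qed


section \<open>The number of accepting paths\<close>

text \<open>The count for a block of which \<open>m\<close> symbols are left, ending before position \<open>q\<close>. Here \<open>G B\<close> is the
  number of accepting paths from the end of the block when \<open>B\<close> letters have been passed on. The truncated
  subtraction \<open>A + B - m\<close> is harmless, as the binomial coefficient is \<open>0\<close> for \<open>m > A\<close>.\<close>

lemma phase_paths_block:
  assumes "\<And>B f. B < 2 ^ L \<Longrightarrow> phase_paths x L (Select f) f q 0 B (G B)"
    and "input_symbol_at x q = Bit False \<or> input_symbol_at x q = Right_End"
    and "A + B < 2 ^ L" "\<And>i. i < m \<Longrightarrow> input_symbol_at x (q - 1 - int i) = Bit True"
  shows "phase_paths x L (Select f) f (q - int m) A B ((A choose m) * G (A + B - m))"
  using assms(3,4)
proof (induction A arbitrary: B m)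
  case 0
  show ?case
  proof (cases m)
    case 0
    then show ?thesis
      using assms(1)[of B f] "0.prems"(1) by simp
  next
    case (Suc m')
    then have "input_symbol_at x (q - int m) = Bit True"
      using "0.prems"(2)[of m'] by (simp add: algebra_simps)
    then show ?thesis
      using phase_paths_consume_stuck by (simp add: Suc)
  qed
next
  case (Suc A)
  show ?case
  proof (cases m)
    case 0
    have "phase_paths x L (Select f) f q (Suc A) B (G (A + Suc B))"
      using Suc.IH[of "Suc B" 0] Suc.prems(1) by (intro phase_paths_transfer[OF assms(2)]) auto
    then show ?thesis by (simp add: 0)
  next
    case m: (Suc m')
    have "phase_paths x L (Select f) f (q - int m + 1) A B ((A choose m') * G (A + B - m'))"
      using Suc.IH[of B m'] Suc.prems by (simp add: m)
    moreover have "phase_paths x L (Select f) f (q - int m) A (Suc B)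
        ((A choose m) * G (A + Suc B - m))"
      using Suc.IH[of "Suc B" m] Suc.prems by simp
    moreover have "input_symbol_at x (q - int m) = Bit True"
      using Suc.prems(2)[of m'] by (simp add: m algebra_simps)
    ultimately have "phase_paths x L (Select f) f (q - int m) (Suc A) B
        ((A choose m') * G (A + B - m') + (A choose m) * G (A + Suc B - m))"
      using Suc.prems(1) by (intro phase_paths_consume_or_transfer) auto
    then show ?thesis
      by (simp add: m distrib_right)
  qed
qed

text \<open>The number of ways to assign blocks to \<open>r\<close> letters so that the blocks get exactly the numbers of
  letters in the list, as a product of binomial coefficients.\<close>

fun ways :: "nat \<Rightarrow> nat list \<Rightarrow> nat" where
  "ways r [] = of_bool (r = 0)"
| "ways r (a # as) = (r choose a) * ways (r - a) as"

lemma input_symbol_at_append: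
  "i < length ys \<Longrightarrow> input_symbol_at (xs @ ys) (int (length xs) + 1 + int i) = Bit (ys ! i)"
  by (auto simp: input_symbol_at_def nth_append nat_add_distrib)

lemma input_symbol_at_end: "input_symbol_at xs (int (length xs) + 1) = Right_End"
  by (simp add: input_symbol_at_def)

lemma phase_paths_select:
  assumes "x = pre @ encode (m, as)" "A + B < 2 ^ L"
  shows "phase_paths x L (Select f) f (int (length pre) + 1) A B
           ((A choose m) * ways (A + B - m) as)"
  using assms
proof (induction as arbitrary: pre A B m f)
  case Nil
  define q where "q = int (length x) + 1"
  have "phase_paths x L (Select f) f (q - int m) A B ((A choose m) * ways (A + B - m) [])"
  proof (rule phase_paths_block)
    show "phase_paths x L (Select f) f q 0 B (ways B [])" for B f
      unfolding ways.simps q_def by (intro phase_paths_finish input_symbol_at_end)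
    show "input_symbol_at x (q - 1 - int i) = Bit True" if "i < m" for i
      using that input_symbol_at_append[of "m - 1 - i" "replicate m True" pre] Nil.prems(1)
      by (simp add: q_def of_nat_diff algebra_simps)
    show "input_symbol_at x q = Bit False \<or> input_symbol_at x q = Right_End"
      unfolding q_def by (intro disjI2 input_symbol_at_end)
  qed (rule Nil.prems(2))
  then show ?case using Nil.prems(1) by (simp add: q_def add.commute)
next
  case (Cons a as)
  define q where "q = int (length pre) + int m + 1"
  have x: "x = (pre @ replicate m True @ [False]) @ encode (a, as)"
    using Cons.prems(1) by simp
  have q: "input_symbol_at x q = Bit False"
    using input_symbol_at_append[of m "encode (m, a # as)" pre] Cons.prems(1)
    by (simp add: q_def nth_append algebra_simps)
  have "phase_paths x L (Select f) f (q - int m) A B ((A choose m) * ways (A + B - m) (a # as))"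
  proof (rule phase_paths_block)
    show "phase_paths x L (Select f) f q 0 B (ways B (a # as))" if "B < 2 ^ L" for B f
    proof (rule phase_paths_next_block[OF q that])
      show "phase_paths x L (Select (\<not> f)) (\<not> f) (q + 1) B 0 (ways B (a # as))"
        using Cons.IH[OF x, of B 0 "\<not> f"] that by (simp add: q_def algebra_simps)
    qed
    show "input_symbol_at x (q - 1 - int i) = Bit True" if "i < m" for i
      using that input_symbol_at_append[of "m - 1 - i" "encode (m, a # as)" pre] Cons.prems(1)
      by (simp add: q_def of_nat_diff nth_append algebra_simps)
  qed (use Cons.prems q in auto)
  then show ?case by (simp add: q_def add.commute)
qed

text \<open>Going backwards from the state in which all of \<open>1\<^sup>n\<close> has been loaded.\<close>

lemma phase_paths_load:
  assumes "k \<le> n" "n < 2 ^ L" "\<And>i. i < n \<Longrightarrow> input_symbol_at x (int i + 1) = Bit True"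
    and "phase_paths x L Load False (int n + 1) n 0 v"
  shows "phase_paths x L Load False (int k + 1) k 0 v"
  using assms(1)
proof (induction k rule: inc_induct)
  case (step k)
  then show ?case
    using assms(2) phase_paths_load_True[of x "int k + 1" k L 0 v] assms(3)[of k]
    by (simp add: add.commute add.left_commute)
qed (rule assms(4))

lemma paths_initial:
  assumes "phase_paths x L Load False 1 0 0 v"
  shows "paths x L (initial_config machine) v"
proof -
  have "paths x L (conf (Phase Load) 1 (tape_of []) 0) v"
    using assms by (simp add: phase_paths_def roles_def)
  then show ?thesis
    unfolding initial_config_machine
    by - (rule paths_det[where s = Marker and d = Move_Right and e = Stay],
        simp_all add: tape_of_initial input_symbol_at_def)
qed

lemma paths_encode:
  assumes "length (encode (n, as)) < 2 ^ L"
  shows "paths (encode (n, as)) L (initial_config machine) (if as = [] then 0 else ways n as)"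
proof -
  define x where "x = encode (n, as)"
  define v where "v = (if as = [] then 0 else ways n as)"
  have n: "n < 2 ^ L"
    using assms by simp
  have "phase_paths x L Load False (int n + 1) n 0 v"
  proof (cases as)
    case Nil
    then show ?thesis
      using phase_paths_load_end input_symbol_at_end[of x] by (simp add: x_def v_def)
  next
    case (Cons a bs)
    have sym: "input_symbol_at x (int n + 1) = Bit False"
      using input_symbol_at_append[of n x "[]"] by (simp add: x_def Cons nth_append add.commute)
    have x: "x = (replicate n True @ [False]) @ encode (a, bs)"
      by (simp add: x_def Cons)
    have "phase_paths x L (Select False) False (int n + 1 + 1) n 0 v"
      using phase_paths_select[OF x, of n 0 L False] n by (simp add: v_def Cons)
    then show ?thesis
      by (rule phase_paths_load_False[OF sym])
  qed
  then have "phase_paths x L Load False (int 0 + 1) 0 0 v"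
  proof (rule phase_paths_load[rotated -1])
    show "input_symbol_at x (int i + 1) = Bit True" if "i < n" for i
      using that input_symbol_at_append[of i x "[]"] by (simp add: x_def nth_append add.commute)
  qed (use n in simp_all)
  then show ?thesis
    using paths_initial by (simp add: x_def v_def)
qed

lemma ways_eq_0: "sum_list as \<noteq> n \<Longrightarrow> ways n as = 0"
proof (induction as arbitrary: n)
  case (Cons a as)
  then show ?case
    by (cases "a \<le> n") (auto simp: binomial_eq_0)
qed simp

lemma ways_mult_fact: "sum_list as = n \<Longrightarrow> (\<Prod>a\<leftarrow>as. fact a) * ways n as = fact n"
proof (induction as arbitrary: n)
  case (Cons a as)
  then have "a \<le> n" "sum_list as = n - a"
    by auto
  then have "(\<Prod>a\<leftarrow>a # as. fact a) * ways n (a # as) = fact a * fact (n - a) * (n choose a)"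
    using Cons.IH[of "n - a"] by (simp add: ac_simps)
  then show ?case
    using binomial_fact_lemma[OF \<open>a \<le> n\<close>] by simp
qed simp

lemma ways_eq_multinomial:
  assumes "sum_list as = n"
  shows "ways n as = multinomial n as"
proof -
  have "(\<Prod>a\<leftarrow>as. fact a) \<noteq> (0 :: nat)"
    by (induction as) auto
  then show ?thesis
    unfolding multinomial_def ways_mult_fact[OF assms, symmetric] by simp
qed

lemma multinomial_string_eq_ways:
  "multinomial_string (encode (n, as)) = (if as = [] then 0 else ways n as)"
proof (cases "as \<noteq> [] \<and> sum_list as = n")
  case True
  then show ?thesis
    by (simp add: multinomial_string_encode ways_eq_multinomial del: encode.simps)
next
  case False
  then have "multinomial_string (encode (n, as)) = 0"
    by (intro multinomial_string_other) (metis encode_eq_iff)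
  then show ?thesis
    using False ways_eq_0 by auto
qed

text \<open>Every string has the form \<open>1\<^sup>n 0 1\<^bsup>a\<^sub>1\<^esup> 0 \<dots> 0 1\<^bsup>a\<^sub>k\<^esup>\<close>, possibly with \<open>k = 0\<close>, so no other inputs
  have to be considered.\<close>

lemma encode_surj: "\<exists>n as. x = encode (n, as)"
proof (induction x)
  case Nil
  have "[] = encode (0, [])" by simp
  then show ?case by blast
next
  case (Cons b x)
  then obtain n as where "x = encode (n, as)" by blast
  then have "b # x = (if b then encode (Suc n, as) else encode (0, n # as))"
    by simp
  then show ?case by metis
qed

lemma paths_machine:
  assumes "length x < 2 ^ L"
  shows "paths x L (initial_config machine) (multinomial_string x)"
proof -
  obtain n as where x: "x = encode (n, as)"
    using encode_surj by blast
  show ?thesis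
    using paths_encode[of n as L] assms
    unfolding x multinomial_string_eq_ways by blast
qed


section \<open>Membership in the counting class\<close>

lemma path_space_machine:
  assumes "length x < 2 ^ L" "partial_path machine x cs"
  shows "path_space machine cs \<le> L + 2"
proof -
  have "head_within L c" if "c \<in> set cs" for c
    using path_count_invariant[OF paths_machine[OF assms(1)], of cs c] assms(2) that
    by (simp add: partial_path_def)
  then have "(\<lambda>c. snd (work_tapes c ! 0)) ` set cs \<subseteq> {0..int L + 1}"
    by (auto simp: head_within_def)
  from card_mono[OF _ this] show ?thesis
    by (simp add: path_space_def machine_def)
qed

lemma uses_log_space_machine: "uses_log_space machine"
proof -
  define L where "L n = nat \<lfloor>log 2 (real n)\<rfloor> + 1" for n
  have "n < 2 ^ L n" for n
  proof (cases "n = 0")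
    case False
    then have "log 2 (real n) < real (L n)"
      unfolding L_def by linarith
    then have "real n < 2 powr real (L n)"
      using False by (simp add: less_powr_iff)
    then have "real n < real (2 ^ L n)"
      by (simp add: powr_realpow)
    then show ?thesis
      using of_nat_less_iff by blast
  qed (simp add: L_def)
  then have "\<forall>x cs. partial_path machine x cs \<longrightarrow> path_space machine cs \<le> L (length x) + 2"
    using path_space_machine by blast
  \<comment> \<open>For \<open>n \<ge> 2\<close> the space is at most \<open>log\<^sub>2 n + 3 \<le> 4 log\<^sub>2 n\<close>.\<close>
  moreover have "(\<lambda>n. real (L n + 2)) \<in> O(\<lambda>n. ln (real n))"
  proof (rule bigoI[where c = "4 / ln 2"])
    show "\<forall>\<^sub>F n in sequentially. norm (real (L n + 2)) \<le> 4 / ln 2 * norm (ln (real n))"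
      using eventually_ge_at_top[of 2]
    proof eventually_elim
      case (elim n)
      then have "1 \<le> log 2 (real n)"
        by (simp add: le_log_iff)
      then have "real (L n + 2) \<le> 4 * log 2 (real n)"
        unfolding L_def by linarith
      then show ?case
        using elim by (simp add: log_def)
    qed
  qed
  ultimately show ?thesis
    unfolding uses_log_space_def by (intro exI[of _ "\<lambda>n. L n + 2"] conjI)
qed

theorem theorem3p2:
  shows "multinomial_string \<in> sharp_L"
proof -
  have "\<exists>L. paths x L (initial_config machine) (multinomial_string x)" for x
    using paths_machine[of x "length x"] by (meson less_exp)
  then obtain L where L: "\<And>x. paths x (L x) (initial_config machine) (multinomial_string x)"
    by metis
  have "halts_on_every_path machine x" for x
    using path_count_no_infinite_path[OF L] by (auto simp: halts_on_every_path_def)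
  moreover have "multinomial_string x = card (accepting_paths machine x)" for x
  proof -
    have "accepting_paths machine x = accepting_paths_from machine x (initial_config machine)"
      by (auto simp: accepting_paths_def accepting_paths_from_def partial_path_def)
    then show ?thesis
      using path_count_card[OF L] by simp
  qed
  ultimately show ?thesis
    unfolding sharp_L_def using well_formed_machine uses_log_space_machine by blast
qed

end
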